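(* Let $H(\Delta)$ be the entropy-distortion function of the sawbridge. If $\Delta\ge 1/6$, then $H(\Delta)=0$. For every $0<\Delta<1/6$, $$H(\Delta) = -\left\lfloor \tfrac{1}{p}\right\rfloor p\log p - q\log q,$$ where $q = 1 - \lfloor 1/p\rfloor\, p$ and $p$ is the unique number in $(0,1)$ such that $$\left\lfloor \tfrac{1}{p}\right\rfloor p^2 + q^2 = 6\Delta.$$
   Context: Let $U$ be uniformly distributed on $[0,1]$. The sawbridge is the random process $X(t) = t - \mathbf{1}(t\ge U)$, $t\in[0,1]$, viewed as a random element of $L^2[0,1]$. An encoder is a (measurable) map $f:L^2[0,1]\to\mathbb{N}$. Its entropy and distortion are $$H(f) = -\sum_{i\in\mathbb{N}} P(f(X)=i)\log P(f(X)=i),\qquad D(f) = E\Big[\int_0^1 \big(X(t)-E[X(t)\mid f(X)]\big)^2\,dt\Big].$$ All logarithms are base 2 (with $0\log 0=0$). The entropy-distortion function is $H(\Delta) = \inf\{H(f): f \text{ an encoder with } D(f)\le\Delta\}$. *)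

theory Defs
  imports "HOL-Analysis.Analysis"
begin

definition sawbridge :: "real \<Rightarrow> real \<Rightarrow> real" where
  "sawbridge u t = t - (if t \<ge> u then 1 else 0)"

definition U_dist :: "real measure" where
  "U_dist = uniform_measure lborel {0..1}"

text \<open>Representatives of elements of L^2[0,1] (functions real => real, only
  their values on [0,1] matter).\<close>
definition L2_01 :: "(real \<Rightarrow> real) set" where
  "L2_01 = {x. (\<lambda>t. indicator {0..1} t * x t) \<in> borel_measurable lborel
             \<and> set_integrable lborel {0..1::real} (\<lambda>t. (x t)\<^sup>2)}"

definition L2_dist2 :: "(real \<Rightarrow> real) \<Rightarrow> (real \<Rightarrow> real) \<Rightarrow> real" where
  "L2_dist2 x y = (LINT t:{0..1}|lborel. (x t - y t)\<^sup>2)"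

text \<open>Borel sigma-algebra of L^2[0,1]: generated by the open balls of the L^2
  (pseudo)metric (L^2[0,1] is separable, so this is the Borel sigma-algebra).\<close>
definition L2_borel :: "(real \<Rightarrow> real) measure" where
  "L2_borel = sigma L2_01
     {{x \<in> L2_01. L2_dist2 x y < r} | y r. y \<in> L2_01 \<and> r > 0}"

definition encoder :: "((real \<Rightarrow> real) \<Rightarrow> nat) \<Rightarrow> bool" where
  "encoder f \<longleftrightarrow> f \<in> measurable L2_borel (count_space UNIV)"

definition cell_prob :: "((real \<Rightarrow> real) \<Rightarrow> nat) \<Rightarrow> nat \<Rightarrow> real" where
  "cell_prob f i = measure U_dist {u \<in> space U_dist. f (sawbridge u) = i}"

definition entropy :: "((real \<Rightarrow> real) \<Rightarrow> nat) \<Rightarrow> ennreal" where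
  "entropy f = (\<Sum>i. ennreal (if cell_prob f i = 0 then 0
                                else - cell_prob f i * log 2 (cell_prob f i)))"

definition cond_mean :: "((real \<Rightarrow> real) \<Rightarrow> nat) \<Rightarrow> nat \<Rightarrow> real \<Rightarrow> real" where
  "cond_mean f i t =
     (\<integral>u. indicator {u. f (sawbridge u) = i} u * sawbridge u t \<partial>U_dist) / cell_prob f i"

definition distortion :: "((real \<Rightarrow> real) \<Rightarrow> nat) \<Rightarrow> real" where
  "distortion f =
     (\<integral>u. (LINT t:{0..1}|lborel. (sawbridge u t - cond_mean f (f (sawbridge u)) t)\<^sup>2) \<partial>U_dist)"

definition entropy_distortion :: "real \<Rightarrow> ennreal" where
  "entropy_distortion \<Delta> = (INF f \<in> {f. encoder f \<and> distortion f \<le> \<Delta>}. entropy f)"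

end

theory Submission
  imports Defs "HOL-Probability.Probability_Measure"
begin

text \<open>
  An encoder partitions the jump time into cells \<open>A\<^sub>i\<close> of measure \<open>p\<^sub>i\<close>. With
  \<open>G(t) = |A\<^sub>i \<inter> [0, t]|\<close>, the cell contributes \<open>\<integral> G (p\<^sub>i - G) / p\<^sub>i dt\<close> to the distortion. Since
  \<open>G\<close> is 1-Lipschitz, comparison with a parabola centred at the median of \<open>A\<^sub>i\<close> bounds this below
  by \<open>p\<^sub>i\<^sup>2 / 6\<close>, with equality for intervals. Hence one has to minimize the entropy of
  \<open>(p\<^sub>i)\<close> when its index of coincidence \<open>\<Sum> p\<^sub>i\<^sup>2\<close> is at most \<open>6 \<Delta>\<close>.

  Let \<open>(p, \<dots>, p, q)\<close> be the candidate with \<open>k\<close> entries \<open>p\<close> and \<open>q < p\<close>, and let \<open>a\<close> be the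
  \<open>(k + 1)\<close>-st largest \<open>p\<^sub>i\<close>. If \<open>a = 0\<close>, the constraint forces \<open>q = 0\<close> and \<open>p\<^sub>i = p\<close> for the \<open>k\<close>
  largest entries. Otherwise \<open>0 < a < p\<close>, and some combination \<open>\<Psi>\<close> of \<open>-x ln x\<close>, \<open>x\<close> and a
  nonnegative multiple of \<open>x\<^sup>2\<close> increases on \<open>[0, a]\<close>, decreases on \<open>[a, p]\<close>, increases beyond
  \<open>p\<close> and vanishes at \<open>0\<close>. So the \<open>k\<close> largest entries have \<open>\<Psi>(p\<^sub>i) \<ge> \<Psi>(p)\<close>, the next one
  \<open>\<Psi>(a) \<ge> \<Psi>(q)\<close>, and the rest \<open>\<Psi>(p\<^sub>i) \<ge> 0\<close>; summing gives the entropy bound.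
\<close>

section \<open>Greedy splits of a unit mass\<close>

locale greedy_split =
  fixes k :: nat and p :: real
  assumes parts_le: "k * p \<le> 1" and parts_gt: "1 < (real k + 1) * p"
begin

lemma part_pos: "0 < p"
proof (rule ccontr)
  assume "\<not> 0 < p"
  then have "(real k + 1) * p \<le> 0" by (intro mult_nonneg_nonpos) auto
  then show False using parts_gt by simp
qed

lemma remainder_nonneg: "0 \<le> 1 - k * p"
  using parts_le by simp

lemma remainder_less: "1 - k * p < p"
  using parts_gt by (simp add: algebra_simps)

end

lemma greedy_split_iff_floor:
  assumes "0 < p"
  shows "greedy_split k p \<longleftrightarrow> \<lfloor>1 / p\<rfloor> = int k"
  using assms by (auto simp: greedy_split_def floor_eq_iff field_simps)

lemma obtain_greedy_split:
  assumes "0 < p" "p \<le> 1"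
  obtains k where "0 < k" "greedy_split k p" "\<lfloor>1 / p\<rfloor> = int k"
proof
  have "1 \<le> \<lfloor>1 / p\<rfloor>" using assms by (simp add: le_floor_iff)
  then show "0 < nat \<lfloor>1 / p\<rfloor>" and "\<lfloor>1 / p\<rfloor> = int (nat \<lfloor>1 / p\<rfloor>)" by auto
  then show "greedy_split (nat \<lfloor>1 / p\<rfloor>) p" using greedy_split_iff_floor[OF assms(1)] by blast
qed

definition greedy :: "nat \<Rightarrow> real \<Rightarrow> nat \<Rightarrow> real" where
  "greedy k p i = (if i < k then p else if i = k then 1 - k * p else 0)"

lemma sums_greedy:
  fixes g :: "real \<Rightarrow> real"
  assumes "g 0 = 0"
  shows "(\<lambda>i. g (greedy k p i)) sums (k * g p + g (1 - k * p))"
proof -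
  have "(\<lambda>i. g (greedy k p i)) sums (\<Sum>i<Suc k. g (greedy k p i))"
    using assms by (intro sums_finite) (auto simp: greedy_def)
  then show ?thesis by (simp add: greedy_def)
qed

definition coincidence :: "real \<Rightarrow> real \<Rightarrow> real" where
  "coincidence n p = n * p\<^sup>2 + (1 - n * p)\<^sup>2"

lemma coincidence_strict_mono:
  assumes "0 < n" "1 / (n + 1) \<le> p" "p < p'"
  shows "coincidence n p < coincidence n p'"
proof -
  have "1 \<le> (n + 1) * p" using assms by (simp add: field_simps)
  moreover have "(n + 1) * p < (n + 1) * p'" using assms by (intro mult_strict_left_mono) auto
  ultimately have "2 < (n + 1) * (p + p')" by (simp add: distrib_left)
  then have "0 < n * (p' - p) * ((n + 1) * (p + p') - 2)" using assms by simp
  also have "\<dots> = coincidence n p' - coincidence n p"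
    by (simp add: coincidence_def power2_eq_square algebra_simps)
  finally show ?thesis by simp
qed

lemma (in greedy_split) greedy_split_coincidence:
  assumes "0 < k"
  shows "greedy_split k (coincidence k p)"
proof
  define q where "q = 1 - k * p"
  have remainder: "0 \<le> q" "q < p" using remainder_nonneg remainder_less by (auto simp: q_def)
  have coincidence_eq: "coincidence k p = k * p\<^sup>2 + q\<^sup>2" by (simp add: coincidence_def q_def)
  have "0 < k * (p - q)\<^sup>2" using remainder assms by simp
  also have "\<dots> = (real k + 1) * coincidence k p - (k * p + q)\<^sup>2"
    unfolding coincidence_eq by (simp add: power2_eq_square algebra_simps)
  finally show "1 < (real k + 1) * coincidence k p" by (simp add: q_def)
  have "k * q \<le> k * p" using remainder by (intro mult_left_mono) auto
  then have "(real k + 1) * q \<le> 1" by (simp add: q_def distrib_right)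
  then have "0 \<le> q * (2 - (real k + 1) * q)" using remainder by simp
  also have "\<dots> = (k * p + q)\<^sup>2 - k * coincidence k p"
    unfolding coincidence_eq q_def by (simp add: power2_eq_square algebra_simps)
  finally show "k * coincidence k p \<le> 1" by (simp add: q_def)
qed

lemma coincidence_inj:
  assumes p: "0 < p" "p \<le> 1" and p': "0 < p'" "p' \<le> 1"
    and eq: "coincidence \<lfloor>1 / p\<rfloor> p = coincidence \<lfloor>1 / p'\<rfloor> p'"
  shows "p = p'"
proof -
  obtain k where split: "0 < k" "greedy_split k p" "\<lfloor>1 / p\<rfloor> = int k"
    using obtain_greedy_split[OF p] .
  obtain k' where split': "0 < k'" "greedy_split k' p'" "\<lfloor>1 / p'\<rfloor> = int k'"
    using obtain_greedy_split[OF p'] .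
  define s where "s = coincidence k p"
  have "greedy_split k s" "greedy_split k' s"
    using greedy_split.greedy_split_coincidence[OF split(2,1)]
      greedy_split.greedy_split_coincidence[OF split'(2,1)] eq
    by (auto simp: s_def split(3) split'(3))
  then have "k' = k"
    using greedy_split_iff_floor greedy_split.part_pos by (metis of_nat_eq_iff)
  moreover have "1 / (real k + 1) \<le> r" if "greedy_split k r" for r
    using greedy_split.parts_gt[OF that] by (simp add: field_simps)
  ultimately show ?thesis
    using coincidence_strict_mono[of k p p'] coincidence_strict_mono[of k p' p] split split' eq
    by (cases p p' rule: linorder_cases) auto
qed

lemma coincidence_surj:
  assumes "0 < s" "s \<le> 1"
  shows "\<exists>p. 0 < p \<and> p \<le> 1 \<and> coincidence \<lfloor>1 / p\<rfloor> p = s"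
proof -
  obtain k where k: "0 < k" "greedy_split k s" using obtain_greedy_split[OF assms] .
  then interpret s: greedy_split k s by simp
  have "coincidence k (1 / (real k + 1)) = 1 / (real k + 1)"
    by (simp add: coincidence_def divide_simps) (simp add: power2_eq_square algebra_simps)
  also have "\<dots> < s" using s.parts_gt by (simp add: field_simps)
  finally have left: "coincidence k (1 / (real k + 1)) < s" .
  have "s \<le> 1 / k" using s.parts_le k(1) by (simp add: field_simps)
  also have "\<dots> = coincidence k (1 / k)" using k(1) by (simp add: coincidence_def power2_eq_square)
  finally have right: "s \<le> coincidence k (1 / k)" .
  have "\<exists>p\<ge>1 / (real k + 1). p \<le> 1 / k \<and> coincidence k p = s"
    using left right k(1) unfolding coincidence_def
    by (intro IVT') (auto intro!: continuous_intros simp: field_simps)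
  then obtain p where p: "1 / (real k + 1) \<le> p" "p \<le> 1 / k" "coincidence k p = s" by blast
  have "p \<noteq> 1 / (real k + 1)" using p(3) left by auto
  then have split: "greedy_split k p" using p(1,2) k(1)
    by unfold_locales (simp_all add: field_simps)
  then have "0 < p" by (rule greedy_split.part_pos)
  moreover have "1 / k \<le> 1" using k(1) by simp
  ultimately show ?thesis
    using p split greedy_split_iff_floor[of p k] by (intro exI[of _ p]) auto
qed

lemma ex1_coincidence:
  assumes "0 < s" "s < 1"
  shows "\<exists>!p. 0 < p \<and> p < 1 \<and> coincidence \<lfloor>1 / p\<rfloor> p = s"
proof -
  obtain p where p: "0 < p" "p \<le> 1" "coincidence \<lfloor>1 / p\<rfloor> p = s"
    using coincidence_surj[of s] assms by auto
  then have "p \<noteq> 1" using assms by (auto simp: coincidence_def)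
  then show ?thesis
    using p coincidence_inj by (intro ex1I[of _ p]) auto
qed

section \<open>Entropy under a bound on the index of coincidence\<close>

definition entropy_term :: "real \<Rightarrow> real" where
  "entropy_term x = - x * log 2 x"

lemma entropy_term_nonneg: "0 \<le> x \<Longrightarrow> x \<le> 1 \<Longrightarrow> 0 \<le> entropy_term x"
  by (cases "x = 0") (auto simp: entropy_term_def mult_nonneg_nonpos)

lemma ln_2_entropy_term: "ln 2 * entropy_term x = - x * ln x"
  by (simp add: entropy_term_def log_def)

definition greedy_entropy :: "nat \<Rightarrow> real \<Rightarrow> real" where
  "greedy_entropy k p = k * entropy_term p + entropy_term (1 - k * p)"

lemma ex_max_outside:
  fixes x :: "nat \<Rightarrow> 'a :: linorder_topology"
  assumes lower: "\<And>i. l \<le> x i" and lim: "x \<longlonglongrightarrow> l" and fin: "finite I"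
  shows "\<exists>j. j \<notin> I \<and> (\<forall>i. i \<notin> I \<longrightarrow> x i \<le> x j)"
proof (cases "\<exists>m. m \<notin> I \<and> l < x m")
  case True
  then obtain m where m: "m \<notin> I" "l < x m" by blast
  obtain N where N: "\<And>n. n \<ge> N \<Longrightarrow> x n < x m"
    using order_tendstoD(2)[OF lim m(2)] unfolding eventually_sequentially by blast
  define S where "S = insert m ({..<N} - I)"
  have "Max (x ` S) \<in> x ` S" by (rule Max_in) (auto simp: S_def)
  then obtain j where j: "j \<in> S" "x j = Max (x ` S)" by auto
  have max: "x i \<le> x j" if "i \<in> S" for i
    unfolding j(2) using that by (intro Max_ge) (auto simp: S_def)
  have "x i \<le> x j" if "i \<notin> I" for i
    using that max[of i] max[of m] N[of i] by (cases "i < N") (force simp: S_def)+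
  then show ?thesis using j(1) m(1) by (auto simp: S_def)
next
  case False
  then have "x i = l" if "i \<notin> I" for i using that lower[of i] by force
  then show ?thesis using ex_new_if_finite[OF infinite_UNIV_nat fin] by (metis order_refl)
qed

lemma ex_largest_values:
  fixes x :: "nat \<Rightarrow> 'a :: linorder_topology"
  assumes "\<And>i. l \<le> x i" "x \<longlonglongrightarrow> l"
  shows "\<exists>I. finite I \<and> card I = k \<and> (\<forall>i\<in>I. \<forall>j. j \<notin> I \<longrightarrow> x j \<le> x i)"
proof (induction k)
  case 0
  show ?case by (intro exI[of _ "{}"]) auto
next
  case (Suc k)
  then obtain I where I: "finite I" "card I = k" "\<forall>i\<in>I. \<forall>j. j \<notin> I \<longrightarrow> x j \<le> x i" by blast
  obtain j where j: "j \<notin> I" "\<forall>i. i \<notin> I \<longrightarrow> x i \<le> x j"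
    using ex_max_outside[OF assms I(1)] by blast
  show ?case using I j by (intro exI[of _ "insert j I"]) auto
qed

definition chord_slope :: "(real \<Rightarrow> real) \<Rightarrow> real \<Rightarrow> real \<Rightarrow> real" where
  "chord_slope f a b = (f b - f a) / (b - a)"

definition chord :: "(real \<Rightarrow> real) \<Rightarrow> real \<Rightarrow> real \<Rightarrow> real \<Rightarrow> real" where
  "chord f a b x = f a + chord_slope f a b * (x - a)"

lemma concave_on_chord_le:
  assumes f: "concave_on S f" and x: "a \<in> S" "b \<in> S" "a \<le> x" "x \<le> b"
  shows "chord f a b x \<le> f x"
proof -
  have "{a..b} \<subseteq> S"
    using closed_segment_subset[OF x(1,2) concave_on_imp_convex[OF f]] x(3,4)
    by (simp add: closed_segment_eq_real_ivl)
  then have "concave_on {a..b} f" using f by (auto simp: concave_on_def intro: convex_on_subset)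
  then show ?thesis using concave_onD_Icc'[of a b f x] x(3,4)
    by (simp add: chord_def chord_slope_def)
qed

lemma concave_on_le_chord:
  assumes f: "concave_on S f" and S: "a \<in> S" "b \<in> S" "x \<in> S" and x: "a < b" "x \<le> a \<or> b \<le> x"
  shows "f x \<le> chord f a b x"
proof -
  consider (left) "x < a" | (endpoint) "x = a" | (right) "b \<le> x" using x by linarith
  then show ?thesis
  proof cases
    case left
    then show ?thesis
      using concave_on_chord_le[OF f S(3,2), of a] x
      by (simp add: chord_def chord_slope_def field_simps)
  next
    case right
    then show ?thesis
      using concave_on_chord_le[OF f S(1,3), of b] x
      by (simp add: chord_def chord_slope_def field_simps)
  qed (simp add: chord_def)
qed

text \<open>The linear and quadratic terms make the derivative the gap between the chord of \<open>ln\<close>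
  through \<open>a\<close>, \<open>b\<close> and \<open>ln\<close> itself, which changes sign only at \<open>a\<close> and \<open>b\<close>.\<close>

definition tilted_entropy :: "real \<Rightarrow> real \<Rightarrow> real \<Rightarrow> real" where
  "tilted_entropy a b x =
     - x * ln x + (1 + chord ln a b 0) * x + chord_slope ln a b / 2 * x\<^sup>2"

lemma tilted_entropy_deriv:
  assumes "0 < x"
  shows "(tilted_entropy a b has_real_derivative chord ln a b x - ln x) (at x)"
  unfolding tilted_entropy_def[abs_def] chord_def using assms
  by (auto intro!: derivative_eq_intros simp: algebra_simps)

context
  fixes a b :: real
  assumes ab: "0 < a" "a < b"
begin

lemma chord_slope_ln_nonneg: "0 \<le> chord_slope ln a b"
  using ab by (simp add: chord_slope_def)

lemma tilted_entropy_nonneg: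
  assumes "0 \<le> x" "x \<le> a"
  shows "0 \<le> tilted_entropy a b x"
proof (cases "x = 0")
  case False
  define \<beta> where "\<beta> = chord_slope ln a b"
  have "ln b - ln a \<le> (b - a) / a" using ab by (intro ln_diff_le) auto
  then have "\<beta> * a \<le> 1" using ab by (simp add: \<beta>_def chord_slope_def field_simps)
  moreover have "0 \<le> \<beta>" using chord_slope_ln_nonneg by (simp add: \<beta>_def)
  moreover have "ln x \<le> ln a" using assms False by simp
  ultimately have "0 \<le> x * ((1 - \<beta> * a) + (ln a - ln x) + \<beta> / 2 * x)"
    using assms by (intro mult_nonneg_nonneg add_nonneg_nonneg) auto
  also have "\<dots> = tilted_entropy a b x"
    by (simp add: tilted_entropy_def chord_def \<beta>_def[symmetric] algebra_simps power2_eq_square)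
  finally show ?thesis .
qed (simp add: tilted_entropy_def)

lemma tilted_entropy_mono:
  assumes "0 < x" "x \<le> y" "y \<le> a \<or> b \<le> x"
  shows "tilted_entropy a b x \<le> tilted_entropy a b y"
proof (rule DERIV_nonneg_imp_nondecreasing[OF \<open>x \<le> y\<close>])
  fix t assume t: "x \<le> t" "t \<le> y"
  then have "ln t \<le> chord ln a b t"
    using ab assms by (intro concave_on_le_chord[OF ln_concave]) auto
  then show "\<exists>d. (tilted_entropy a b has_real_derivative d) (at t) \<and> 0 \<le> d"
    using tilted_entropy_deriv[of t a b] t assms by (intro exI[of _ "chord ln a b t - ln t"]) simp
qed

lemma tilted_entropy_antimono:
  assumes "a \<le> x" "x \<le> y" "y \<le> b"
  shows "tilted_entropy a b y \<le> tilted_entropy a b x"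
proof (rule DERIV_nonpos_imp_nonincreasing[OF \<open>x \<le> y\<close>])
  fix t assume t: "x \<le> t" "t \<le> y"
  then have "chord ln a b t \<le> ln t"
    using ab assms by (intro concave_on_chord_le[OF ln_concave]) auto
  then show "\<exists>d. (tilted_entropy a b has_real_derivative d) (at t) \<and> d \<le> 0"
    using tilted_entropy_deriv[of t a b] t assms ab
    by (intro exI[of _ "chord ln a b t - ln t"]) simp
qed

lemma tilted_entropy_le_left:
  assumes "0 \<le> x" "x \<le> b"
  shows "tilted_entropy a b x \<le> tilted_entropy a b a"
proof (cases "x = 0")
  case True
  then show ?thesis using tilted_entropy_nonneg[of a] ab by (simp add: tilted_entropy_def)
next
  case False
  then show ?thesis
    using assms ab tilted_entropy_mono[of x a] tilted_entropy_antimono[of a x] by linarith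
qed

lemma tilted_entropy_ge_right:
  assumes "a \<le> x"
  shows "tilted_entropy a b b \<le> tilted_entropy a b x"
  using assms ab tilted_entropy_mono[of b x] tilted_entropy_antimono[of x b] by linarith

end

lemma greedy_entropy_le_if_tilted_entropy_le:
  assumes ab: "0 < a" "a < b"
    and total: "x sums 1" and squares: "(\<lambda>i. (x i)\<^sup>2) sums s" "s \<le> coincidence k p"
    and entropy: "(\<lambda>i. entropy_term (x i)) sums h"
    and tilted_le: "\<And>t. (\<lambda>i. tilted_entropy a b (x i)) sums t
      \<Longrightarrow> k * tilted_entropy a b p + tilted_entropy a b (1 - k * p) \<le> t"
  shows "greedy_entropy k p \<le> h"
proof -
  define \<beta> where "\<beta> = chord_slope ln a b / 2"
  define \<gamma> where "\<gamma> = 1 + chord ln a b 0"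
  have tilted: "tilted_entropy a b y = ln 2 * entropy_term y + \<gamma> * y + \<beta> * y\<^sup>2" for y
    by (simp add: tilted_entropy_def \<gamma>_def \<beta>_def ln_2_entropy_term)
  have "(\<lambda>i. tilted_entropy a b (x i)) sums (ln 2 * h + \<gamma> * 1 + \<beta> * s)"
    unfolding tilted by (intro sums_add sums_mult entropy total squares(1))
  from tilted_le[OF this]
  have "ln 2 * greedy_entropy k p + \<beta> * coincidence k p \<le> ln 2 * h + \<beta> * s"
    by (simp add: tilted greedy_entropy_def coincidence_def algebra_simps)
  moreover have "\<beta> * s \<le> \<beta> * coincidence k p"
    using chord_slope_ln_nonneg[OF ab] squares(2) by (intro mult_left_mono) (auto simp: \<beta>_def)
  ultimately have "ln 2 * greedy_entropy k p \<le> ln 2 * h" by linarith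
  then show ?thesis by simp
qed

context greedy_split
begin

lemma equal_parts_if_coincidence_le:
  assumes I: "finite I" "card I = k" "(\<Sum>i\<in>I. x i) = 1" "(\<Sum>i\<in>I. (x i)\<^sup>2) \<le> coincidence k p"
  shows "k * p = 1" "\<And>i. i \<in> I \<Longrightarrow> x i = p"
proof -
  define q where "q = 1 - k * p"
  have remainder: "0 \<le> q" "q < p" using remainder_nonneg remainder_less by (auto simp: q_def)
  have "(\<Sum>i\<in>I. (x i - p)\<^sup>2) = (\<Sum>i\<in>I. (x i)\<^sup>2) - 2 * p * (\<Sum>i\<in>I. x i) + k * p\<^sup>2"
    using I(2)
    by (simp add: power2_diff sum.distrib sum_subtractf sum_distrib_left sum_distrib_right
        algebra_simps)
  also have "\<dots> \<le> (k * p\<^sup>2 + q\<^sup>2) - 2 * p * (k * p + q) + k * p\<^sup>2"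
    using I(3,4) by (simp add: coincidence_def q_def)
  also have "\<dots> = q * (q - 2 * p)" by (simp add: power2_eq_square algebra_simps)
  also have "\<dots> \<le> 0" using remainder by (intro mult_nonneg_nonpos) auto
  finally have "(\<Sum>i\<in>I. (x i - p)\<^sup>2) = 0" by (intro antisym sum_nonneg) auto
  then show "x i = p" if "i \<in> I" for i using I(1) that by (simp add: sum_nonneg_eq_0_iff)
  then show "k * p = 1" using I(2,3) by simp
qed

lemma value_outside_largest_less:
  assumes x: "\<And>i. 0 \<le> x i" "x sums 1"
    and I: "finite I" "card I = k" "j \<notin> I" "\<And>i. i \<in> I \<Longrightarrow> x j \<le> x i"
  shows "x j < p"
proof (rule ccontr)
  assume "\<not> x j < p"
  then have "p \<le> x i" if "i \<in> insert j I" for i using that I(4)[of i] by force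
  then have "real (card (insert j I)) * p \<le> (\<Sum>i\<in>insert j I. x i)" by (intro sum_bounded_below)
  also have "\<dots> \<le> 1"
    using sum_le_suminf[of x "insert j I"] x I(1) by (simp add: sums_iff)
  finally show False using I(1-3) parts_gt by (simp add: add.commute)
qed

lemma tilted_entropy_sum_ge:
  assumes critical: "0 < x j" "x j < p" and nonneg: "\<And>i. 0 \<le> x i"
    and I: "finite I" "card I = k" "\<And>i. i \<in> I \<Longrightarrow> x j \<le> x i"
    and j: "j \<notin> I" "\<And>i. i \<notin> I \<Longrightarrow> x i \<le> x j"
    and sums: "(\<lambda>i. tilted_entropy (x j) p (x i)) sums s"
  shows "k * tilted_entropy (x j) p p + tilted_entropy (x j) p (1 - k * p) \<le> s"
proof -
  let ?T = "tilted_entropy (x j) p"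
  have "k * ?T p \<le> (\<Sum>i\<in>I. ?T (x i))"
    unfolding I(2)[symmetric] by (intro sum_bounded_below tilted_entropy_ge_right[OF critical] I(3))
  moreover have "?T (1 - k * p) \<le> ?T (x j)"
    using remainder_nonneg remainder_less by (intro tilted_entropy_le_left[OF critical]) auto
  ultimately have "k * ?T p + ?T (1 - k * p) \<le> (\<Sum>i\<in>insert j I. ?T (x i))" using I(1) j(1) by simp
  also have "\<dots> \<le> (\<Sum>i. ?T (x i))"
    using sums I(1) nonneg j(2)
    by (intro sum_le_suminf tilted_entropy_nonneg[OF critical]) (auto simp: sums_iff)
  also have "\<dots> = s" using sums by (simp add: sums_iff)
  finally show ?thesis .
qed

lemma entropy_sums_if_concentrated:
  assumes I: "finite I" "card I = k" and outside: "\<And>i. i \<notin> I \<Longrightarrow> x i = 0"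
    and total: "x sums 1" and squares: "(\<lambda>i. (x i)\<^sup>2) sums s" "s \<le> coincidence k p"
  shows "(\<lambda>i. entropy_term (x i)) sums greedy_entropy k p"
proof -
  have sums: "(\<lambda>i. g (x i)) sums (\<Sum>i\<in>I. g (x i))" if "g 0 = 0" for g :: "real \<Rightarrow> real"
    using I(1) outside that by (intro sums_finite) auto
  have "(\<Sum>i\<in>I. x i) = 1" "(\<Sum>i\<in>I. (x i)\<^sup>2) \<le> coincidence k p"
    using sums[of "\<lambda>y. y"] sums[of "\<lambda>y. y\<^sup>2"] total squares by (auto dest: sums_unique2)
  note parts = equal_parts_if_coincidence_le[OF I this]
  have "(\<Sum>i\<in>I. entropy_term (x i)) = greedy_entropy k p"
    using parts I(2) by (simp add: greedy_entropy_def entropy_term_def)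
  then show ?thesis using sums[of entropy_term] by (simp add: entropy_term_def)
qed

lemma greedy_entropy_le:
  assumes nonneg: "\<And>i. 0 \<le> x i" and total: "x sums 1"
    and squares: "(\<lambda>i. (x i)\<^sup>2) sums s" "s \<le> coincidence k p"
    and entropy: "(\<lambda>i. entropy_term (x i)) sums h"
  shows "greedy_entropy k p \<le> h"
proof -
  have "x \<longlonglongrightarrow> 0" using total by (auto simp: sums_iff intro: summable_LIMSEQ_zero)
  then obtain I j where I: "finite I" "card I = k" "\<And>i. i \<in> I \<Longrightarrow> x j \<le> x i"
    and j: "j \<notin> I" "\<And>i. i \<notin> I \<Longrightarrow> x i \<le> x j"
    using ex_largest_values[of 0 x k] ex_max_outside[of 0 x] nonneg by metis
  show ?thesis
  proof (cases "x j = 0")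
    case True
    then have "x i = 0" if "i \<notin> I" for i using that j(2)[of i] nonneg[of i] by simp
    then have "(\<lambda>i. entropy_term (x i)) sums greedy_entropy k p"
      using I(1,2) total squares by (intro entropy_sums_if_concentrated)
    then show ?thesis using sums_unique2[OF entropy] by simp
  next
    case False
    then have critical: "0 < x j" "x j < p"
      using nonneg[of j] value_outside_largest_less[OF nonneg total I(1,2) j(1) I(3)] by auto
    then show ?thesis
      using total squares entropy tilted_entropy_sum_ge[where x=x, OF critical nonneg I j]
      by (rule greedy_entropy_le_if_tilted_entropy_le)
  qed
qed

end

section \<open>Mass functions of sets\<close>

lemma has_integral_parabola:
  fixes a b :: real
  assumes "a \<le> b"
  shows "((\<lambda>t. (t - a) * (b - t)) has_integral (b - a) ^ 3 / 6) {a..b}"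
proof -
  define F where "F t = (b - a) * (t - a)\<^sup>2 / 2 - (t - a) ^ 3 / 3" for t
  have "((\<lambda>t. (t - a) * (b - t)) has_integral F b - F a) {a..b}"
    unfolding F_def using assms
    by (intro fundamental_theorem_of_calculus)
      (auto intro!: derivative_eq_intros
        simp: has_real_derivative_iff_has_vector_derivative[symmetric] power2_eq_square field_simps)
  also have "F b - F a = (b - a) ^ 3 / 6"
    by (simp add: F_def power2_eq_square power3_eq_cube)
  finally show ?thesis .
qed

lemma lipschitz_integral_ge:
  fixes G :: "real \<Rightarrow> real"
  assumes lip: "1-lipschitz_on {a..b} G" and "a \<le> b" and ends: "G a = 0" "G b = P"
    and range: "\<And>t. t \<in> {a..b} \<Longrightarrow> G t \<in> {0..P}"
  shows "P ^ 3 / 6 \<le> integral {a..b} (\<lambda>t. G t * (P - G t))"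
proof -
  have P_nonneg: "0 \<le> P" using range[of a] \<open>a \<le> b\<close> ends by simp
  have cont: "continuous_on {a..b} G" using lip by (rule lipschitz_on_continuous_on)
  then obtain c where median: "a \<le> c" "c \<le> b" "G c = P / 2"
    using IVT'[of G a "P / 2" b] P_nonneg ends \<open>a \<le> b\<close> by auto
  define l r where "l = c - P / 2" and "r = c + P / 2"
  have "l \<le> r" using P_nonneg by (simp add: l_def r_def)
  have dist: "\<bar>G t - P / 2\<bar> \<le> \<bar>t - c\<bar>" if "t \<in> {a..b}" for t
    using lipschitz_onD[OF lip that, of c] median by (simp add: dist_real_def)
  then have sub: "{l..r} \<subseteq> {a..b}"
    using dist[of a] dist[of b] median(1,2) ends P_nonneg \<open>a \<le> b\<close> by (auto simp: l_def r_def)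
  have integrable: "(\<lambda>t. G t * (P - G t)) integrable_on {u..v}" if "{u..v} \<subseteq> {a..b}" for u v
    using that continuous_on_subset[OF cont]
    by (intro integrable_continuous_interval continuous_intros) auto
  have parabola_le: "(t - l) * (r - t) \<le> G t * (P - G t)" if "t \<in> {l..r}" for t
  proof -
    have "(G t - P / 2)\<^sup>2 \<le> (t - c)\<^sup>2" using dist[of t] that sub by (auto simp: abs_le_square_iff)
    then show ?thesis by (simp add: l_def r_def power2_eq_square algebra_simps)
  qed
  have "P ^ 3 / 6 = integral {l..r} (\<lambda>t. (t - l) * (r - t))"
    using has_integral_parabola[OF \<open>l \<le> r\<close>] by (simp add: integral_unique l_def r_def)
  also have "\<dots> \<le> integral {l..r} (\<lambda>t. G t * (P - G t))"
    using has_integral_parabola[OF \<open>l \<le> r\<close>] integrable[OF sub]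
    by (intro integral_le parabola_le) (auto simp: integrable_on_def)
  also have "\<dots> \<le> integral {a..b} (\<lambda>t. G t * (P - G t))"
    using sub range by (intro integral_subset_le integrable mult_nonneg_nonneg) auto
  finally show ?thesis .
qed

lemma has_integral_clamp:
  fixes a b :: real
  assumes "a \<le> b" "{a..b} \<subseteq> S"
  defines "G \<equiv> \<lambda>t. max 0 (min b t - a)"
  shows "((\<lambda>t. G t * (b - a - G t)) has_integral (b - a) ^ 3 / 6) S"
proof (rule has_integral_on_superset[OF _ _ assms(2)])
  show "((\<lambda>t. G t * (b - a - G t)) has_integral (b - a) ^ 3 / 6) {a..b}"
    by (rule has_integral_eq[OF _ has_integral_parabola[OF assms(1)]])
      (simp add: G_def max_def min_def)
qed (use assms(1) in \<open>auto simp: G_def max_def min_def\<close>)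

definition mass_upto :: "real set \<Rightarrow> real \<Rightarrow> real" where
  "mass_upto A t = measure lborel (A \<inter> {0..t})"

lemma mass_upto_0 [simp]: "mass_upto A 0 = 0"
proof -
  have "A \<inter> {0..0} = (if 0 \<in> A then {0} else {})" by auto
  then show ?thesis by (simp add: mass_upto_def)
qed

lemma mass_upto_Int_atMost:
  assumes "t \<le> 1"
  shows "mass_upto (A \<inter> {..t}) 1 = mass_upto A t"
proof -
  have "A \<inter> {..t} \<inter> {0..1} = A \<inter> {0..t}" using assms by auto
  then show ?thesis by (simp add: mass_upto_def)
qed

definition mass_dispersion :: "real set \<Rightarrow> real" where
  "mass_dispersion A = integral {0..1} (\<lambda>t. mass_upto A t * (mass_upto A 1 - mass_upto A t))"

context
  fixes A :: "real set" and a b :: real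
  assumes A: "A \<inter> {0..1} = {a..<b} \<inter> {0..1}" and ab: "0 \<le> a" "a \<le> b"
begin

lemma mass_upto_half_open:
  assumes "t \<le> 1"
  shows "mass_upto A t = max 0 (min b t - a)"
proof -
  have "A \<inter> {0..t} = (A \<inter> {0..1}) \<inter> {..t}" using assms by auto
  also have "\<dots> = (if b \<le> t then {a..<b} else {a..t})"
    unfolding A using assms ab by auto
  finally show ?thesis using ab by (auto simp: mass_upto_def)
qed

lemma mass_upto_1_half_open: "mass_upto A 1 = min 1 b - min 1 a"
  using mass_upto_half_open[of 1] ab by (auto simp: min_def)

lemma mass_dispersion_half_open: "mass_dispersion A = mass_upto A 1 ^ 3 / 6"
proof -
  define l r where "l = min 1 a" and "r = min 1 b"
  have lr: "0 \<le> l" "l \<le> r" "r \<le> 1" using ab by (auto simp: l_def r_def)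
  have mass: "mass_upto A t = max 0 (min r t - l)" if "t \<le> 1" for t
    using mass_upto_half_open[OF that] that by (auto simp: l_def r_def min_def)
  have total: "mass_upto A 1 = r - l" using mass_upto_1_half_open by (simp add: l_def r_def)
  have "((\<lambda>t. mass_upto A t * (mass_upto A 1 - mass_upto A t)) has_integral (r - l) ^ 3 / 6) {0..1}"
    using lr by (intro has_integral_eq[OF _ has_integral_clamp[of l r]]) (auto simp: mass total)
  then show ?thesis by (simp add: mass_dispersion_def total integral_unique)
qed

end

context
  fixes A :: "real set"
  assumes A [measurable]: "A \<in> sets borel"
begin

lemma fmeasurable_Int_Icc: "A \<inter> {s..t} \<in> fmeasurable lborel"
  by (rule fmeasurableI2[OF fmeasurable_cbox[of s t]]) auto

lemma mass_upto_mono: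
  assumes "s \<le> t"
  shows "mass_upto A s \<le> mass_upto A t"
  unfolding mass_upto_def using assms
  by (intro measure_mono_fmeasurable fmeasurable_Int_Icc) auto

lemma mass_upto_diff_le:
  assumes "s \<le> t"
  shows "mass_upto A t - mass_upto A s \<le> t - s"
proof -
  have "mass_upto A t \<le> measure lborel (A \<inter> {0..s} \<union> {s..t})"
    unfolding mass_upto_def
    using fmeasurable_cbox[of s t]
    by (intro measure_mono_fmeasurable fmeasurable.Un fmeasurable_Int_Icc) auto
  also have "\<dots> \<le> mass_upto A s + measure lborel {s..t}"
    unfolding mass_upto_def by (rule measure_Un_le) auto
  finally show ?thesis using assms by simp
qed

lemma mass_upto_lipschitz: "1-lipschitz_on X (mass_upto A)"
proof (rule lipschitz_onI)
  fix s t
  show "dist (mass_upto A s) (mass_upto A t) \<le> 1 * dist s t"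
    using mass_upto_mono[of s t] mass_upto_mono[of t s]
      mass_upto_diff_le[of s t] mass_upto_diff_le[of t s]
    by (simp add: dist_real_def) linarith
qed simp

lemma mass_dispersion_ge: "mass_upto A 1 ^ 3 / 6 \<le> mass_dispersion A"
  unfolding mass_dispersion_def using mass_upto_mono[of 0] mass_upto_mono[of _ 1]
  by (intro lipschitz_integral_ge mass_upto_lipschitz) auto

end

section \<open>The uniform jump time\<close>

interpretation U: prob_space U_dist
  unfolding U_dist_def by (rule prob_space_uniform_measure) auto

interpretation UU: pair_prob_space U_dist U_dist ..

lemma sets_U_dist [simp, measurable_cong]: "sets U_dist = sets borel"
  by (simp add: U_dist_def)

lemma space_U_dist [simp]: "space U_dist = UNIV"
  by (simp add: U_dist_def)

lemma AE_U_dist: "AE t in U_dist. t \<in> {0..1}"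
  unfolding U_dist_def by (rule AE_uniform_measureI) auto

lemma measure_U_dist: "A \<in> sets borel \<Longrightarrow> measure U_dist A = mass_upto A 1"
  by (simp add: U_dist_def mass_upto_def Int_commute)

lemma integral_U_dist:
  fixes f :: "real \<Rightarrow> real"
  assumes "f \<in> borel_measurable borel"
  shows "(\<integral>t. f t \<partial>U_dist) = (LINT t:{0..1}|lborel. f t)"
proof -
  have "U_dist = density lborel (\<lambda>t. ennreal (indicator {0..1} t))"
    unfolding U_dist_def uniform_measure_def
    by (rule density_cong) (auto split: split_indicator)
  then show ?thesis
    using assms integral_real_density[of "indicator {0..1}" lborel f]
    by (simp add: set_lebesgue_integral_def)
qed

lemma integral_U_dist_continuous:
  fixes f :: "real \<Rightarrow> real"
  assumes "continuous_on UNIV f"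
  shows "(\<integral>t. f t \<partial>U_dist) = integral {0..1} f"
proof -
  have "set_integrable lborel {0..1} f"
    by (intro borel_integrable_atLeastAtMost' continuous_on_subset[OF assms]) simp
  then show ?thesis
    using assms
    by (simp add: integral_U_dist borel_measurable_continuous_onI set_borel_integral_eq_integral)
qed

lemma integrable_U_dist_pair_bounded:
  fixes h :: "real \<Rightarrow> real \<Rightarrow> real"
  assumes h: "case_prod h \<in> borel_measurable (borel \<Otimes>\<^sub>M borel)"
    and bound: "\<And>u t. t \<in> {0..1} \<Longrightarrow> \<bar>h u t\<bar> \<le> B"
  shows "integrable (U_dist \<Otimes>\<^sub>M U_dist) (case_prod h)"
proof (rule UU.P.integrable_const_bound[where B=B])
  show meas: "case_prod h \<in> borel_measurable (U_dist \<Otimes>\<^sub>M U_dist)" using h by measurable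
  show "AE z in U_dist \<Otimes>\<^sub>M U_dist. norm (case_prod h z) \<le> B"
  proof (rule UU.AE_pair_measure)
    show "{z \<in> space (U_dist \<Otimes>\<^sub>M U_dist). norm (case_prod h z) \<le> B} \<in> sets (U_dist \<Otimes>\<^sub>M U_dist)"
      using meas by measurable
    show "AE u in U_dist. AE t in U_dist. norm (case_prod h (u, t)) \<le> B"
      by (intro AE_I2 eventually_mono[OF AE_U_dist]) (simp add: bound)
  qed
qed

section \<open>Sawbridge paths\<close>

lemma borel_measurable_sawbridge [measurable (raw)]:
  assumes [measurable]: "g \<in> borel_measurable M" "h \<in> borel_measurable M"
  shows "(\<lambda>x. sawbridge (g x) (h x)) \<in> borel_measurable M"
  unfolding sawbridge_def by measurable

lemma sawbridge_range: "sawbridge u t \<in> {t - 1..t}"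
  by (simp add: sawbridge_def)

lemma sawbridge_L2: "sawbridge u \<in> L2_01"
proof -
  have "set_integrable lborel {0..1} (\<lambda>t. (sawbridge u t)\<^sup>2)"
    unfolding set_integrable_def
  proof (rule integrableI_bounded_set_indicator[where B=1])
    show "AE t in lborel. t \<in> {0..1} \<longrightarrow> norm ((sawbridge u t)\<^sup>2) \<le> 1"
      by (auto simp: sawbridge_def abs_square_le_1)
  qed auto
  then show ?thesis by (auto simp: L2_01_def)
qed

lemma id_L2: "(\<lambda>t. t) \<in> L2_01"
proof -
  have "set_integrable lborel {0..1} (\<lambda>t::real. t\<^sup>2)"
    by (intro borel_integrable_atLeastAtMost' continuous_intros)
  then show ?thesis by (simp add: L2_01_def)
qed

lemma L2_dist2_measurable:
  assumes "y \<in> L2_01"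
  shows "(\<lambda>x. L2_dist2 x y) \<in> borel_measurable L2_borel"
proof (rule borel_measurableI_less)
  fix r :: real
  have space: "space L2_borel = L2_01" unfolding L2_borel_def by (rule space_measure_of) auto
  show "{x \<in> space L2_borel. L2_dist2 x y < r} \<in> sets L2_borel"
  proof (cases "r > 0")
    case True
    then show ?thesis unfolding space unfolding L2_borel_def
      using assms by (intro in_measure_of) auto
  next
    case False
    have "L2_dist2 x y \<ge> 0" for x
      unfolding L2_dist2_def set_lebesgue_integral_def by (rule integral_nonneg_AE) auto
    then have "{x \<in> space L2_borel. L2_dist2 x y < r} = {}"
      using False by (auto simp: not_less intro: order_trans)
    then show ?thesis by (simp only: sets.empty_sets)
  qed
qed

lemma sawbridge_measurable [measurable]: "sawbridge \<in> measurable borel L2_borel"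
  unfolding L2_borel_def
proof (rule measurable_measure_of)
  fix B assume "B \<in> {{x \<in> L2_01. L2_dist2 x y < r} |y r. y \<in> L2_01 \<and> 0 < r}"
  then obtain y r where y: "y \<in> L2_01" and B: "B = {x \<in> L2_01. L2_dist2 x y < r}" by auto
  have [measurable]: "(\<lambda>t. indicator {0..1} t * y t) \<in> borel_measurable lborel"
    using y by (simp add: L2_01_def)
  have dist: "L2_dist2 (sawbridge u) y =
      (\<integral>t. indicator {0..1} t * (sawbridge u t - indicator {0..1} t * y t)\<^sup>2 \<partial>lborel)" for u
    unfolding L2_dist2_def set_lebesgue_integral_def
    by (rule Bochner_Integration.integral_cong) (auto split: split_indicator)
  have "(\<lambda>u. L2_dist2 (sawbridge u) y) \<in> borel_measurable borel"
    unfolding dist by measurable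
  then have "{u. L2_dist2 (sawbridge u) y < r} \<in> sets borel" by measurable
  moreover have "sawbridge -` B \<inter> space borel = {u. L2_dist2 (sawbridge u) y < r}"
    using sawbridge_L2 by (auto simp: B)
  ultimately show "sawbridge -` B \<inter> space borel \<in> sets borel" by simp
qed (use sawbridge_L2 in auto)

text \<open>On \<open>[0, 1]\<close> the sawbridge jumping at \<open>u\<close> differs from the identity by the indicator of
  \<open>[u, 1]\<close>, whose squared norm is \<open>1 - u\<close>.\<close>

definition jump_time :: "(real \<Rightarrow> real) \<Rightarrow> real" where
  "jump_time x = 1 - L2_dist2 x (\<lambda>t. t)"

lemma jump_time_measurable [measurable]: "jump_time \<in> borel_measurable L2_borel"
  unfolding jump_time_def using L2_dist2_measurable[OF id_L2] by measurable

lemma jump_time_sawbridge: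
  assumes "u \<in> {0..1}"
  shows "jump_time (sawbridge u) = u"
proof -
  have "L2_dist2 (sawbridge u) (\<lambda>t. t) = (\<integral>t. indicator {u..1} t \<partial>lborel)"
    unfolding L2_dist2_def set_lebesgue_integral_def using assms
    by (intro Bochner_Integration.integral_cong) (auto simp: sawbridge_def split: split_indicator)
  also have "\<dots> = 1 - u" using assms by simp
  finally show ?thesis by (simp add: jump_time_def)
qed

context
  fixes A :: "real set" and t :: real
  assumes A [measurable]: "A \<in> sets borel" and t: "t \<le> 1"
begin

lemma set_integral_sawbridge:
  "(LINT u:A|U_dist. sawbridge u t) = t * mass_upto A 1 - mass_upto A t"
proof -
  have "(LINT u:A|U_dist. sawbridge u t)
      = (\<integral>u. t * indicator A u - indicator (A \<inter> {..t}) u \<partial>U_dist)"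
    unfolding set_lebesgue_integral_def
    by (rule Bochner_Integration.integral_cong) (auto split: split_indicator simp: sawbridge_def)
  also have "\<dots> = t * mass_upto A 1 - mass_upto A t"
    using t by (subst Bochner_Integration.integral_diff)
      (simp_all add: U.emeasure_eq_measure measure_U_dist mass_upto_Int_atMost)
  finally show ?thesis .
qed

lemma set_integral_sawbridge_deviation:
  "(LINT u:A|U_dist. (sawbridge u t - (t - r))\<^sup>2)
    = r\<^sup>2 * mass_upto A 1 + (1 - 2 * r) * mass_upto A t"
proof -
  have "(LINT u:A|U_dist. (sawbridge u t - (t - r))\<^sup>2)
      = (\<integral>u. r\<^sup>2 * indicator A u + (1 - 2 * r) * indicator (A \<inter> {..t}) u \<partial>U_dist)"
    unfolding set_lebesgue_integral_def
    by (rule Bochner_Integration.integral_cong)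
      (auto split: split_indicator simp: sawbridge_def power2_eq_square algebra_simps)
  also have "\<dots> = r\<^sup>2 * mass_upto A 1 + (1 - 2 * r) * mass_upto A t"
    using t by (subst Bochner_Integration.integral_add)
      (simp_all add: U.emeasure_eq_measure measure_U_dist mass_upto_Int_atMost)
  finally show ?thesis .
qed

end

section \<open>Distortion of an encoder\<close>

lemma set_integral_sums:
  fixes f :: "'a \<Rightarrow> 'b :: {banach, second_countable_topology}"
  assumes A: "\<And>i::nat. A i \<in> sets M" "disjoint_family A"
    and f: "set_integrable M (\<Union>i. A i) f"
  shows "(\<lambda>i. LINT x:A i|M. f x) sums (LINT x:(\<Union>i. A i)|M. f x)"
proof -
  have UN: "(\<Union>n. \<Union>i<n. A i) = (\<Union>i. A i)" by auto
  have "(\<lambda>n. LINT x:(\<Union>i<n. A i)|M. f x) \<longlonglongrightarrow> (LINT x:(\<Union>n. \<Union>i<n. A i)|M. f x)"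
    using A(1) f UN by (intro set_integral_cont_up incseq_SucI) (auto simp: lessThan_Suc)
  moreover have "(LINT x:(\<Union>i<n. A i)|M. f x) = (\<Sum>i<n. LINT x:A i|M. f x)" for n
    using A f
    by (intro set_integral_finite_Union)
      (auto intro: disjoint_family_on_mono set_integrable_subset)
  ultimately show ?thesis by (simp add: sums_def UN)
qed

definition cell :: "((real \<Rightarrow> real) \<Rightarrow> nat) \<Rightarrow> nat \<Rightarrow> real set" where
  "cell f i = {u. f (sawbridge u) = i}"

definition squared_error :: "((real \<Rightarrow> real) \<Rightarrow> nat) \<Rightarrow> real \<Rightarrow> real" where
  "squared_error f u = (\<integral>t. (sawbridge u t - cond_mean f (f (sawbridge u)) t)\<^sup>2 \<partial>U_dist)"

definition cell_distortion :: "((real \<Rightarrow> real) \<Rightarrow> nat) \<Rightarrow> nat \<Rightarrow> real" where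
  "cell_distortion f i = (LINT u:cell f i|U_dist. squared_error f u)"

lemma cell_prob_eq_measure: "cell_prob f i = measure U_dist (cell f i)"
  by (simp add: cell_prob_def cell_def)

lemma cell_prob_nonneg: "0 \<le> cell_prob f i"
  and cell_prob_le_1: "cell_prob f i \<le> 1"
  by (simp_all add: cell_prob_eq_measure)

lemma disjoint_family_cell: "disjoint_family (cell f)"
  by (auto simp: disjoint_family_on_def cell_def)

lemma UN_cell: "(\<Union>i. cell f i) = UNIV"
  by (auto simp: cell_def)

context
  fixes f :: "(real \<Rightarrow> real) \<Rightarrow> nat"
  assumes f: "encoder f"
begin

lemma encoder_sawbridge_measurable [measurable]:
  "(\<lambda>u. f (sawbridge u)) \<in> measurable borel (count_space UNIV)"
  using measurable_compose[OF sawbridge_measurable, of f] f by (simp add: encoder_def)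

lemma cell_measurable [measurable]: "cell f i \<in> sets borel"
  unfolding cell_def by measurable

lemma cell_prob_eq_mass: "cell_prob f i = mass_upto (cell f i) 1"
  by (simp add: cell_prob_eq_measure measure_U_dist)

lemma cell_prob_sums: "cell_prob f sums 1"
proof -
  have "(\<lambda>i. measure U_dist (cell f i)) sums measure U_dist (\<Union>i. cell f i)"
    using cell_measurable disjoint_family_cell by (intro U.finite_measure_UNION) auto
  then show ?thesis
    using U.prob_space by (simp add: cell_prob_eq_measure[abs_def] UN_cell)
qed

lemma mass_upto_cell_bounds:
  assumes "t \<in> {0..1}"
  shows "0 \<le> mass_upto (cell f i) t" "mass_upto (cell f i) t \<le> cell_prob f i"
  using assms mass_upto_mono[OF cell_measurable, of 0 t i]
    mass_upto_mono[OF cell_measurable, of t 1 i]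
  by (simp_all add: cell_prob_eq_mass)

lemma cond_mean_eq:
  assumes "t \<le> 1"
  shows "cond_mean f i t = (t * cell_prob f i - mass_upto (cell f i) t) / cell_prob f i"
  using set_integral_sawbridge[OF cell_measurable assms, of i]
  by (simp add: cond_mean_def cell_def[symmetric] set_lebesgue_integral_def cell_prob_eq_mass)

lemma cond_mean_range:
  assumes "t \<in> {0..1}"
  shows "cond_mean f i t \<in> {t - 1..t}"
proof (cases "cell_prob f i = 0")
  case True
  then show ?thesis using assms by (simp add: cond_mean_def)
next
  case False
  then have "0 < cell_prob f i" using cell_prob_nonneg[of f i] by simp
  then show ?thesis
    using mass_upto_cell_bounds[OF assms, of i] assms
    by (simp add: cond_mean_eq pos_le_divide_eq pos_divide_le_eq left_diff_distrib)
qed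

lemma cond_mean_measurable [measurable]: "cond_mean f i \<in> borel_measurable borel"
  unfolding cond_mean_def[abs_def] cell_def[symmetric] by measurable

lemma cond_mean_sawbridge_measurable [measurable]:
  "(\<lambda>z. cond_mean f (f (sawbridge (fst z))) (snd z)) \<in> borel_measurable (borel \<Otimes>\<^sub>M borel)"
  by (rule measurable_compose_countable[where f="\<lambda>i z. cond_mean f i (snd z)"
        and g="\<lambda>z. f (sawbridge (fst z))"]) measurable

lemma deviation_sq_le_1:
  assumes "t \<in> {0..1}"
  shows "(sawbridge u t - cond_mean f i t)\<^sup>2 \<le> 1"
  using sawbridge_range[of u t] cond_mean_range[OF assms, of i]
  by (auto simp: abs_square_le_1)

lemma integrable_squared_error: "integrable U_dist (squared_error f)"
proof -
  have "integrable (U_dist \<Otimes>\<^sub>M U_dist)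
      (\<lambda>(u, t). (sawbridge u t - cond_mean f (f (sawbridge u)) t)\<^sup>2)"
    by (rule integrable_U_dist_pair_bounded[where B=1])
      (auto simp: deviation_sq_le_1 case_prod_beta)
  then show ?thesis unfolding squared_error_def[abs_def] by (rule UU.integrable_fst)
qed

lemma distortion_eq_integral: "distortion f = (\<integral>u. squared_error f u \<partial>U_dist)"
  unfolding distortion_def squared_error_def
  by (intro Bochner_Integration.integral_cong refl integral_U_dist[symmetric]) measurable

lemma cell_distortion_sums: "cell_distortion f sums distortion f"
proof -
  have "cell_distortion f sums (LINT u:(\<Union>i. cell f i)|U_dist. squared_error f u)"
    unfolding cell_distortion_def[abs_def]
    using integrable_squared_error disjoint_family_cell
    by (intro set_integral_sums) (auto simp: UN_cell set_integrable_def)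
  then show ?thesis by (simp add: UN_cell set_lebesgue_integral_def distortion_eq_integral)
qed

lemma set_integral_cell_deviation_sq:
  assumes "t \<in> {0..1}"
  shows "(LINT u:cell f i|U_dist. (sawbridge u t - cond_mean f i t)\<^sup>2)
    = mass_upto (cell f i) t * (cell_prob f i - mass_upto (cell f i) t) / cell_prob f i"
proof -
  let ?P = "cell_prob f i" and ?G = "mass_upto (cell f i) t"
  define r where "r = t - cond_mean f i t"
  have "(LINT u:cell f i|U_dist. (sawbridge u t - cond_mean f i t)\<^sup>2) = r\<^sup>2 * ?P + (1 - 2 * r) * ?G"
    using set_integral_sawbridge_deviation[OF cell_measurable, of t i r] assms
    by (simp add: r_def cell_prob_eq_mass)
  also have "\<dots> = ?G * (?P - ?G) / ?P"
  proof (cases "?P = 0")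
    case True
    then show ?thesis using mass_upto_cell_bounds[OF assms, of i] by simp
  next
    case False
    then have "r = ?G / ?P" using assms by (simp add: r_def cond_mean_eq field_simps)
    then show ?thesis using False by (simp add: field_simps power2_eq_square)
  qed
  finally show ?thesis .
qed

lemma cell_distortion_eq: "cell_distortion f i = mass_dispersion (cell f i) / cell_prob f i"
proof -
  let ?A = "cell f i" and ?P = "cell_prob f i"
  let ?G = "mass_upto ?A"
  have cont: "continuous_on UNIV ?G"
    using mass_upto_lipschitz[OF cell_measurable] by (rule lipschitz_on_continuous_on)
  then have [measurable]: "?G \<in> borel_measurable borel" by (rule borel_measurable_continuous_onI)
  have "cell_distortion f i
      = (\<integral>u. (\<integral>t. indicator ?A u * (sawbridge u t - cond_mean f i t)\<^sup>2 \<partial>U_dist) \<partial>U_dist)"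
    unfolding cell_distortion_def squared_error_def set_lebesgue_integral_def
    by (intro Bochner_Integration.integral_cong) (auto split: split_indicator simp: cell_def)
  also have "\<dots> = (\<integral>t. (\<integral>u. indicator ?A u * (sawbridge u t - cond_mean f i t)\<^sup>2 \<partial>U_dist) \<partial>U_dist)"
  proof (rule UU.Fubini_integral[symmetric], rule integrable_U_dist_pair_bounded[where B=1])
    show "(\<lambda>(u, t). indicator ?A u * (sawbridge u t - cond_mean f i t)\<^sup>2)
        \<in> borel_measurable (borel \<Otimes>\<^sub>M borel)"
      unfolding case_prod_beta by measurable
  qed (auto split: split_indicator simp: deviation_sq_le_1)
  also have "\<dots> = (\<integral>t. ?G t * (?P - ?G t) / ?P \<partial>U_dist)"
  proof (rule integral_cong_AE)
    show "AE t in U_dist. (\<integral>u. indicator ?A u * (sawbridge u t - cond_mean f i t)\<^sup>2 \<partial>U_dist)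
        = ?G t * (?P - ?G t) / ?P"
      using AE_U_dist
      by eventually_elim
        (simp add: set_integral_cell_deviation_sq[symmetric] set_lebesgue_integral_def)
  qed measurable
  also have "\<dots> = mass_dispersion ?A / ?P"
    using cont
    by (simp add: integral_U_dist_continuous continuous_intros mass_dispersion_def
        cell_prob_eq_mass)
  finally show ?thesis .
qed

lemma cell_distortion_ge: "(cell_prob f i)\<^sup>2 / 6 \<le> cell_distortion f i"
proof -
  have "(cell_prob f i)\<^sup>2 / 6 = (cell_prob f i ^ 3 / 6) / cell_prob f i"
    by (simp add: power2_eq_square power3_eq_cube)
  also have "\<dots> \<le> cell_distortion f i"
    unfolding cell_distortion_eq cell_prob_eq_mass
    using mass_dispersion_ge[OF cell_measurable] cell_prob_nonneg[of f i]
    by (intro divide_right_mono) (auto simp: cell_prob_eq_mass)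
  finally show ?thesis .
qed

lemma
  assumes "cell f i \<inter> {0..1} = {a..<b} \<inter> {0..1}" "0 \<le> a" "a \<le> b"
  shows cell_prob_half_open: "cell_prob f i = min 1 b - min 1 a"
    and cell_distortion_half_open: "cell_distortion f i = (cell_prob f i)\<^sup>2 / 6"
  using mass_upto_1_half_open[OF assms] mass_dispersion_half_open[OF assms]
  by (simp_all add: cell_distortion_eq cell_prob_eq_mass power2_eq_square power3_eq_cube)

lemma cell_prob_power2_sums_le_distortion:
  obtains s where "(\<lambda>i. (cell_prob f i)\<^sup>2) sums s" "s \<le> 6 * distortion f"
proof
  have distortion: "(\<lambda>i. 6 * cell_distortion f i) sums (6 * distortion f)"
    by (intro sums_mult cell_distortion_sums)
  have bound: "(cell_prob f i)\<^sup>2 \<le> 6 * cell_distortion f i" for i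
    using cell_distortion_ge[of i] by simp
  have "summable (\<lambda>i. (cell_prob f i)\<^sup>2)"
    using bound by (intro summable_comparison_test'[OF sums_summable[OF distortion]]) simp
  then show sums: "(\<lambda>i. (cell_prob f i)\<^sup>2) sums (\<Sum>i. (cell_prob f i)\<^sup>2)" by (rule summable_sums)
  show "(\<Sum>i. (cell_prob f i)\<^sup>2) \<le> 6 * distortion f"
    using bound sums_le[OF _ sums distortion] by simp
qed

end

lemma entropy_eq_suminf: "entropy f = (\<Sum>i. ennreal (entropy_term (cell_prob f i)))"
proof -
  have "(if x = 0 then 0 else - x * log 2 x) = entropy_term x" for x
    by (simp add: entropy_term_def)
  then show ?thesis unfolding entropy_def by simp
qed

lemma entropy_term_cell_prob_nonneg: "0 \<le> entropy_term (cell_prob f i)"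
  using cell_prob_nonneg cell_prob_le_1 by (rule entropy_term_nonneg)

section \<open>The greedy quantizer is optimal\<close>

definition quantizer :: "real \<Rightarrow> (real \<Rightarrow> real) \<Rightarrow> nat" where
  "quantizer p x = nat \<lfloor>jump_time x / p\<rfloor>"

lemma encoder_quantizer: "encoder (quantizer p)"
  unfolding encoder_def quantizer_def by measurable

lemma cell_quantizer:
  assumes "0 < p"
  shows "cell (quantizer p) i \<inter> {0..1} = {i * p..<(real i + 1) * p} \<inter> {0..1}"
proof -
  have "u \<in> cell (quantizer p) i \<longleftrightarrow> u \<in> {i * p..<(real i + 1) * p}" if "u \<in> {0..1}" for u
  proof -
    have "u \<in> cell (quantizer p) i \<longleftrightarrow> \<lfloor>u / p\<rfloor> = int i"
      using that assms by (auto simp: cell_def quantizer_def jump_time_sawbridge)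
    also have "\<dots> \<longleftrightarrow> u \<in> {i * p..<(real i + 1) * p}"
      using assms by (auto simp: floor_eq_iff field_simps)
    finally show ?thesis .
  qed
  then show ?thesis by blast
qed

context greedy_split
begin

lemma greedy_eq_diff: "greedy k p i = min 1 ((real i + 1) * p) - min 1 (i * p)"
proof -
  consider (part) "i < k" | (remainder) "i = k" | (beyond) "k < i" by linarith
  then show ?thesis
  proof cases
    case part
    then have "(real i + 1) * p \<le> k * p" using part_pos by (intro mult_right_mono) auto
    then show ?thesis using part parts_le part_pos by (simp add: greedy_def algebra_simps)
  next
    case remainder
    then show ?thesis using parts_le parts_gt by (simp add: greedy_def)
  next
    case beyond
    then have "(real k + 1) * p \<le> i * p" using part_pos by (intro mult_right_mono) auto
    then show ?thesis using beyond parts_gt part_pos by (simp add: greedy_def algebra_simps)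
  qed
qed

lemma cell_prob_quantizer: "cell_prob (quantizer p) i = greedy k p i"
  and cell_distortion_quantizer: "cell_distortion (quantizer p) i = (greedy k p i)\<^sup>2 / 6"
proof -
  have "0 \<le> i * p" "i * p \<le> (real i + 1) * p"
    using part_pos by (auto simp: algebra_simps)
  note half_open = encoder_quantizer cell_quantizer[OF part_pos] this
  show prob: "cell_prob (quantizer p) i = greedy k p i"
    using cell_prob_half_open[OF half_open] by (simp add: greedy_eq_diff)
  show "cell_distortion (quantizer p) i = (greedy k p i)\<^sup>2 / 6"
    using cell_distortion_half_open[OF half_open] by (simp add: prob)
qed

lemma distortion_quantizer: "6 * distortion (quantizer p) = coincidence k p"
proof -
  have "(\<lambda>i. (greedy k p i)\<^sup>2) sums (6 * distortion (quantizer p))"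
    using sums_mult[OF cell_distortion_sums[OF encoder_quantizer], of 6 p]
    by (simp add: cell_distortion_quantizer)
  moreover have "(\<lambda>i. (greedy k p i)\<^sup>2) sums coincidence k p"
    using sums_greedy[of "\<lambda>x. x\<^sup>2" k p] by (simp add: coincidence_def)
  ultimately show ?thesis by (rule sums_unique2)
qed

lemma entropy_quantizer: "entropy (quantizer p) = ennreal (greedy_entropy k p)"
  unfolding entropy_eq_suminf greedy_entropy_def
  using sums_greedy[of entropy_term k p]
  by (intro suminf_ennreal_eq entropy_term_cell_prob_nonneg)
    (simp_all add: cell_prob_quantizer entropy_term_def)

lemma greedy_entropy_le_entropy:
  assumes f: "encoder f" and fidelity: "6 * distortion f \<le> coincidence k p"
  shows "ennreal (greedy_entropy k p) \<le> entropy f"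
proof (cases "entropy f = top")
  case False
  have summable: "summable (\<lambda>i. entropy_term (cell_prob f i))"
    using False entropy_term_cell_prob_nonneg unfolding entropy_eq_suminf
    by (intro summable_suminf_not_top)
  obtain s where squares: "(\<lambda>i. (cell_prob f i)\<^sup>2) sums s" "s \<le> 6 * distortion f"
    using cell_prob_power2_sums_le_distortion[OF f] .
  have "greedy_entropy k p \<le> (\<Sum>i. entropy_term (cell_prob f i))"
    using cell_prob_nonneg cell_prob_sums[OF f] squares(1) order_trans[OF squares(2) fidelity]
      summable_sums[OF summable]
    by (rule greedy_entropy_le)
  then have "ennreal (greedy_entropy k p) \<le> ennreal (\<Sum>i. entropy_term (cell_prob f i))"
    by (rule ennreal_leI)
  also have "\<dots> = entropy f"
    unfolding entropy_eq_suminf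
    using entropy_term_cell_prob_nonneg summable by (rule suminf_ennreal2[symmetric])
  finally show ?thesis .
qed simp

lemma entropy_distortion_eq:
  assumes "coincidence k p = 6 * \<Delta>"
  shows "entropy_distortion \<Delta> = ennreal (greedy_entropy k p)"
  unfolding entropy_distortion_def
proof (rule antisym)
  show "(INF f \<in> {f. encoder f \<and> distortion f \<le> \<Delta>}. entropy f) \<le> ennreal (greedy_entropy k p)"
    unfolding entropy_quantizer[symmetric]
    using encoder_quantizer distortion_quantizer assms by (intro INF_lower) simp
  show "ennreal (greedy_entropy k p) \<le> (INF f \<in> {f. encoder f \<and> distortion f \<le> \<Delta>}. entropy f)"
    using assms by (intro INF_greatest greedy_entropy_le_entropy) auto
qed

end

lemma entropy_distortion_antimono: "antimono entropy_distortion"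
  unfolding entropy_distortion_def by (intro antimonoI INF_superset_mono) auto

lemma entropy_distortion_sixth: "entropy_distortion (1 / 6) = 0"
proof -
  interpret greedy_split 1 1 by unfold_locales auto
  show ?thesis
    using entropy_distortion_eq[of "1 / 6"]
    by (simp add: coincidence_def greedy_entropy_def entropy_term_def)
qed

theorem theorem2:
  shows "(\<forall>\<Delta>::real. \<Delta> \<ge> 1/6 \<longrightarrow> entropy_distortion \<Delta> = 0)
    \<and> (\<forall>\<Delta>::real. 0 < \<Delta> \<and> \<Delta> < 1/6 \<longrightarrow>
         (\<exists>!p::real. 0 < p \<and> p < 1 \<and>
            of_int \<lfloor>1/p\<rfloor> * p\<^sup>2 + (1 - of_int \<lfloor>1/p\<rfloor> * p)\<^sup>2 = 6 * \<Delta>)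
       \<and> (\<forall>p::real. 0 < p \<and> p < 1 \<and>
            of_int \<lfloor>1/p\<rfloor> * p\<^sup>2 + (1 - of_int \<lfloor>1/p\<rfloor> * p)\<^sup>2 = 6 * \<Delta> \<longrightarrow>
            (let q = 1 - of_int \<lfloor>1/p\<rfloor> * p in
             entropy_distortion \<Delta> =
               ennreal (- of_int \<lfloor>1/p\<rfloor> * p * log 2 p
                        - (if q = 0 then 0 else q * log 2 q)))))"
  unfolding coincidence_def[symmetric]
proof (intro conjI allI impI)
  fix \<Delta> :: real assume "\<Delta> \<ge> 1/6"
  then show "entropy_distortion \<Delta> = 0"
    using antimonoD[OF entropy_distortion_antimono, of "1/6" \<Delta>]
    by (simp add: entropy_distortion_sixth)
next
  fix \<Delta> :: real assume "0 < \<Delta> \<and> \<Delta> < 1/6"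
  then show "\<exists>!p. 0 < p \<and> p < 1 \<and> coincidence \<lfloor>1/p\<rfloor> p = 6 * \<Delta>"
    by (intro ex1_coincidence) auto
next
  fix \<Delta> p :: real assume p: "0 < p \<and> p < 1 \<and> coincidence \<lfloor>1/p\<rfloor> p = 6 * \<Delta>"
  then obtain k where k: "greedy_split k p" "\<lfloor>1/p\<rfloor> = int k"
    using obtain_greedy_split[of p] by auto
  then have "entropy_distortion \<Delta> = ennreal (greedy_entropy k p)"
    using p by (intro greedy_split.entropy_distortion_eq) auto
  moreover have "(if q = 0 then 0 else q * log 2 q) = q * log 2 q" for q :: real by simp
  ultimately show "let q = 1 - of_int \<lfloor>1/p\<rfloor> * p in
      entropy_distortion \<Delta> = ennreal (- of_int \<lfloor>1/p\<rfloor> * p * log 2 p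
        - (if q = 0 then 0 else q * log 2 q))"
    unfolding k(2) Let_def
    by (simp only: greedy_entropy_def entropy_term_def) (simp add: algebra_simps)
qed

end
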